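(* Let $D_+=\{x_k\}_{k\ge 1}$, with $0<x_1<x_2<\cdots$ integers, be the ordered infinite sequence of trap positions on $\mathbb{Z}_{>0}$. Define the sequences $(p_n)_{n\ge 1}$ and $(q_n)_{n\ge 1}$ by $p_1=x_1$, $q_1=x_1^2$ and, for $n\ge 2$, $$p_n=x_n+\sum_{i=1}^{n-1}(x_n-x_i)\,p_i,\qquad q_n=x_n^2+\sum_{i=1}^{n-1}(x_n-x_i)(q_i+1).$$ Then $\left(\dfrac{q_n}{p_n}\right)_{n\ge 1}$ is a positive increasing sequence, and the model with traps $(x_k)_{k\ge1}$ is critical if and only if $$\lim_{n\to\infty}\frac{q_n}{p_n}=\infty.$$
   Context: The model is the trapped random walk on the half-line: the Markov chain on $\{0,1,2,\dots\}\cup\{s\}$ where $s$ (the sink) and $0$ are absorbing, from $x\ge 1$ with $x\notin D_+$ the walk moves to $x-1$ or $x+1$ with probability $1/2$ each, and from $x\in D_+$ it moves to $x-1$, $x+1$ or $s$ with probability $1/3$ each. Let $T$ be the first time the walk is in $\{0,s\}$, and let $\mathbb{E}_x(T)\in[0,\infty]$ be its expectation for the walk started at $x$. The model is called critical if $\mathbb{E}_1(T)=\infty$ and non-critical if $\mathbb{E}_1(T)<\infty$ (the finiteness of $\mathbb{E}_x(T)$ does not depend on the starting point $x\ge 1$). *)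

theory Defs
  imports "HOL-Probability.Probability"
begin

datatype state = Sink | Site nat

instance state :: countable
  by countable_datatype

text \<open>Since the listed targets are pairwise distinct, the uniform distribution on the set of
  targets gives each of them probability \<open>1/2\<close> resp. \<open>1/3\<close>.\<close>

fun trapped_kernel :: "nat set \<Rightarrow> state \<Rightarrow> state pmf" where
  "trapped_kernel D Sink = return_pmf Sink"
| "trapped_kernel D (Site 0) = return_pmf (Site 0)"
| "trapped_kernel D (Site (Suc y)) =
     (if Suc y \<in> D then pmf_of_set {Site y, Site (Suc (Suc y)), Sink}
      else pmf_of_set {Site y, Site (Suc (Suc y))})"

text \<open>Law on path space of the chain started at \<open>a\<close>, as the Ionescu-Tulcea extension of the
  transition kernel; the coordinate \<open>\<omega> n\<close> of a path is the position at time \<open>n\<close>.\<close>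

definition walk_transition :: "nat set \<Rightarrow> state \<Rightarrow> nat \<Rightarrow> (nat \<Rightarrow> state) \<Rightarrow> state measure" where
  "walk_transition D a n \<omega> =
     (case n of 0 \<Rightarrow> measure_pmf (return_pmf a)
              | Suc m \<Rightarrow> measure_pmf (trapped_kernel D (\<omega> m)))"

definition walk_law :: "nat set \<Rightarrow> state \<Rightarrow> (nat \<Rightarrow> state) measure" where
  "walk_law D a =
     projective_family.lim UNIV
       (Ionescu_Tulcea.CI (walk_transition D a) (\<lambda>_. count_space UNIV))
       (\<lambda>_. count_space UNIV)"

lemma Ionescu_Tulcea_walk_transition:
  "Ionescu_Tulcea (walk_transition D a) (\<lambda>_. count_space UNIV)"
proof (rule Ionescu_Tulcea.intro)
  fix i
  show "walk_transition D a i \<in>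
      measurable (PiM {0..<i} (\<lambda>_. count_space UNIV)) (subprob_algebra (count_space UNIV))"
  proof (cases i)
    case 0
    then show ?thesis
      by (simp add: walk_transition_def[abs_def] measure_pmf_in_subprob_algebra)
  next
    case (Suc m)
    have "(\<lambda>\<omega>. \<omega> m) \<in> measurable (PiM {0..<Suc m} (\<lambda>_. count_space UNIV)) (count_space UNIV)"
      by (rule measurable_component_singleton) simp
    moreover have "(\<lambda>s. measure_pmf (trapped_kernel D s)) \<in>
        measurable (count_space UNIV) (subprob_algebra (count_space UNIV))"
      by (simp add: measure_pmf_in_subprob_algebra)
    ultimately show ?thesis
      unfolding Suc walk_transition_def[abs_def] nat.case by (rule measurable_compose)
  qed
next
  fix i and \<omega> :: "nat \<Rightarrow> state"
  show "prob_space (walk_transition D a i \<omega>)"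
    by (auto simp: walk_transition_def split: nat.split intro: measure_pmf.prob_space_axioms)
qed

lemma
  shows prob_space_walk_law: "prob_space (walk_law D a)"
    and sets_walk_law: "sets (walk_law D a) = sets (PiM UNIV (\<lambda>_. count_space UNIV))"
proof -
  interpret Ionescu_Tulcea "walk_transition D a" "\<lambda>_. count_space UNIV"
    by (rule Ionescu_Tulcea_walk_transition)
  show "sets (walk_law D a) = sets (PiM UNIV (\<lambda>_. count_space UNIV))"
    unfolding walk_law_def by simp
  show "prob_space (walk_law D a)"
  proof
    have "emeasure PF.lim (PF.emb UNIV {} {\<lambda>_. undefined}) = emeasure (CI {}) {\<lambda>_. undefined}"
      by (rule lim) (auto simp: PiM_empty)
    moreover have "PF.emb UNIV {} {\<lambda>_. undefined} = space (PiM UNIV (\<lambda>_. count_space UNIV) :: (nat \<Rightarrow> state) measure)"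
      by (auto simp: prod_emb_def space_PiM)
    moreover have "emeasure (CI {}) {\<lambda>_. undefined} = 1"
    proof -
      interpret p: prob_space "CI {}" by (rule PF.prob_space_P) auto
      have "space (CI {}) = {\<lambda>_. undefined}"
        by (simp add: CI_def space_PiM)
      then show ?thesis using p.emeasure_space_1 by simp
    qed
    ultimately show "emeasure (walk_law D a) (space (walk_law D a)) = 1"
      unfolding walk_law_def by simp
  qed
qed

lemma walk_law_cylinder:
  "emeasure (walk_law D a) {\<omega>. \<forall>i\<le>n. \<omega> i = w i} =
     (if w 0 = a then \<Prod>i<n. ennreal (pmf (trapped_kernel D (w i)) (w (Suc i))) else 0)"
proof -
  let ?M = "\<lambda>_. count_space UNIV :: state measure"
  interpret Ionescu_Tulcea "walk_transition D a" ?M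
    by (rule Ionescu_Tulcea_walk_transition)
  have single: "{restrict w {0..<m}} \<in> sets (PiM {0..<m} ?M)" for m
  proof -
    have "{restrict w {0..<m}} = PiE {0..<m} (\<lambda>i. {w i})"
      by (auto simp: PiE_iff restrict_def extensional_def fun_eq_iff)
    then show ?thesis by (simp add: sets_PiM_I_finite)
  qed
  have space: "\<omega> \<in> space (PiM {0..<m} ?M) \<longleftrightarrow> \<omega> \<in> extensional {0..<m}" for \<omega> m
    by (simp add: space_PiM PiE_iff)
  have step: "emeasure (C 0 (Suc m) (\<lambda>_. undefined)) {restrict w {0..<Suc m}} =
      emeasure (C 0 m (\<lambda>_. undefined)) {restrict w {0..<m}} *
      emeasure (walk_transition D a m (restrict w {0..<m})) {w m}" for m
  proof -
    have "emeasure (C 0 (Suc m) (\<lambda>_. undefined)) {restrict w {0..<Suc m}} =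
        (\<integral>\<^sup>+\<omega>. emeasure (eP m \<omega>) {restrict w {0..<Suc m}} \<partial>C 0 m (\<lambda>_. undefined))"
      using single[of "Suc m"] measurable_eP[of m]
      by (simp add: emeasure_bind[where N="PiM {0..<Suc m} ?M"] space_C
            measurable_cong_sets[OF sets_C refl])
    also have "\<dots> = (\<integral>\<^sup>+\<omega>. emeasure (walk_transition D a m (restrict w {0..<m})) {w m} *
        indicator {restrict w {0..<m}} \<omega> \<partial>C 0 m (\<lambda>_. undefined))"
    proof (rule nn_integral_cong)
      fix \<omega> assume "\<omega> \<in> space (C 0 m (\<lambda>_. undefined))"
      then have \<omega>: "\<omega> \<in> space (PiM {0..<m} ?M)"
        by (simp add: space_C)
      have eq: "fun_upd \<omega> m s = restrict w {0..<Suc m} \<longleftrightarrow> \<omega> = restrict w {0..<m} \<and> s = w m" for s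
        using \<omega> unfolding space by (auto simp: fun_eq_iff extensional_def less_Suc_eq)
      have "emeasure (eP m \<omega>) {restrict w {0..<Suc m}} =
          emeasure (walk_transition D a m \<omega>) ((\<lambda>s. fun_upd \<omega> m s) -` {restrict w {0..<Suc m}} \<inter> UNIV)"
        using emeasure_eP[OF \<omega> single] by simp
      also have "(\<lambda>s. fun_upd \<omega> m s) -` {restrict w {0..<Suc m}} \<inter> UNIV =
          (if \<omega> = restrict w {0..<m} then {w m} else {})"
        by (rule set_eqI) (unfold vimage_eq Int_iff singleton_iff eq, auto)
      finally show "emeasure (eP m \<omega>) {restrict w {0..<Suc m}} =
          emeasure (walk_transition D a m (restrict w {0..<m})) {w m} *
            indicator {restrict w {0..<m}} \<omega>"
        by (auto split: if_splits simp del: restrict_apply restrict_apply' cong del: restrict_cong)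
    qed
    also have "\<dots> = emeasure (walk_transition D a m (restrict w {0..<m})) {w m} *
        emeasure (C 0 m (\<lambda>_. undefined)) {restrict w {0..<m}}"
      using single[of m] by (subst nn_integral_cmult_indicator) (auto simp: sets_C space_PiM)
    finally show ?thesis by (simp add: mult.commute)
  qed
  have C: "emeasure (C 0 (Suc m) (\<lambda>_. undefined)) {restrict w {0..<Suc m}} =
      (if w 0 = a then \<Prod>i<m. ennreal (pmf (trapped_kernel D (w i)) (w (Suc i))) else 0)" for m
  proof (induction m)
    case 0
    have "restrict w {0..<0} = (\<lambda>_. undefined)" by auto
    then have "emeasure (C 0 0 (\<lambda>_. undefined)) {restrict w {0..<0}} = 1"
      by (simp add: emeasure_return PiM_empty)
    then show ?case
      unfolding step by (simp add: walk_transition_def emeasure_pmf_single pmf_return)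
  next
    case (Suc m)
    have "emeasure (walk_transition D a (Suc m) (restrict w {0..<Suc m})) {w (Suc m)} =
        ennreal (pmf (trapped_kernel D (w m)) (w (Suc m)))"
      by (simp add: walk_transition_def emeasure_pmf_single)
    then show ?case
      unfolding step[of "Suc m"] Suc.IH by simp
  qed
  have "{\<omega>. \<forall>i\<le>n. \<omega> i = w i} = PF.emb UNIV {0..<Suc n} {restrict w {0..<Suc n}}"
    by (auto simp: prod_emb_def fun_eq_iff less_Suc_eq_le) metis
  then have "emeasure (walk_law D a) {\<omega>. \<forall>i\<le>n. \<omega> i = w i} =
      emeasure (CI {0..<Suc n}) {restrict w {0..<Suc n}}"
    unfolding walk_law_def using lim[OF _ single] by simp
  also have "\<dots> = emeasure (C 0 (Suc n) (\<lambda>_. undefined)) {restrict w {0..<Suc n}}"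
    using emeasure_CI[OF subset_refl single[of "Suc n"]] single[of "Suc n"]
    by (simp add: prod_emb_id space_PiM PiE_iff)
  finally show ?thesis unfolding C .
qed

text \<open>The infimum is \<open>\<infinity>\<close> for a path that is never absorbed.\<close>

definition absorption_time :: "(nat \<Rightarrow> state) \<Rightarrow> ennreal" where
  "absorption_time \<omega> = (INF n\<in>{n. \<omega> n \<in> {Site 0, Sink}}. of_nat n)"

lemma measurable_absorption_time: "absorption_time \<in> borel_measurable (walk_law D a)"
proof -
  have "{\<omega> :: nat \<Rightarrow> state. \<omega> n \<in> A} \<in> sets (PiM UNIV (\<lambda>_. count_space UNIV))" for n A
    using measurable_sets[OF measurable_component_singleton[of n UNIV "\<lambda>_. count_space UNIV :: state measure"], of A]
    by (simp add: vimage_def space_PiM)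
  then have *: "{\<omega>. \<omega> n \<in> A} \<in> sets (walk_law D a)" for n A
    by (simp add: sets_walk_law)
  have space: "space (walk_law D a) = UNIV"
    using sets_eq_imp_space_eq[OF sets_walk_law] by (simp add: space_PiM)
  have "absorption_time = (\<lambda>\<omega>. INF n. if \<omega> n \<in> {Site 0, Sink} then of_nat n else \<infinity>)"
    unfolding absorption_time_def fun_eq_iff
  proof
    fix \<omega> :: "nat \<Rightarrow> state"
    show "(INF n\<in>{n. \<omega> n \<in> {Site 0, Sink}}. of_nat n) =
        (INF n. if \<omega> n \<in> {Site 0, Sink} then of_nat n else (\<infinity> :: ennreal))"
    proof (intro antisym INF_greatest)
      fix n
      show "(INF n\<in>{n. \<omega> n \<in> {Site 0, Sink}}. of_nat n) \<le>
          (if \<omega> n \<in> {Site 0, Sink} then of_nat n else (\<infinity> :: ennreal))"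
        by (simp add: INF_lower)
    next
      fix n assume "n \<in> {n. \<omega> n \<in> {Site 0, Sink}}"
      then show "(INF n. if \<omega> n \<in> {Site 0, Sink} then of_nat n else (\<infinity> :: ennreal)) \<le> of_nat n"
        by (intro INF_lower2[of n]) auto
    qed
  qed
  also have "\<dots> \<in> borel_measurable (walk_law D a)"
    using *[of _ "{Site 0, Sink}"] by (intro borel_measurable_INF measurable_If) (auto simp: space)
  finally show ?thesis .
qed

definition expected_absorption_time :: "nat set \<Rightarrow> nat \<Rightarrow> ennreal" where
  "expected_absorption_time D y = (\<integral>\<^sup>+\<omega>. absorption_time \<omega> \<partial>walk_law D (Site y))"

definition critical :: "nat set \<Rightarrow> bool" where
  "critical D \<longleftrightarrow> expected_absorption_time D 1 = \<infinity>"

text \<open>In the two recursions only indices \<open>n \<ge> 1\<close> are meaningful. For \<open>n = 1\<close> the sums are empty,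
  so that \<open>p\<^sub>1 = x\<^sub>1\<close> and \<open>q\<^sub>1 = x\<^sub>1\<^sup>2\<close>.\<close>

fun trap_p :: "(nat \<Rightarrow> nat) \<Rightarrow> nat \<Rightarrow> real" where
  "trap_p x n = real (x n) + (\<Sum>i=1..<n. (real (x n) - real (x i)) * trap_p x i)"

fun trap_q :: "(nat \<Rightarrow> nat) \<Rightarrow> nat \<Rightarrow> real" where
  "trap_q x n = (real (x n))\<^sup>2 + (\<Sum>i=1..<n. (real (x n) - real (x i)) * (trap_q x i + 1))"

declare trap_p.simps [simp del] trap_q.simps [simp del]

end

theory Submission
  imports Defs
begin

text \<open>Let \<open>P\<close> and \<open>Q\<close> be the functions on the sites with \<open>P 0 = Q 0 = 0\<close>, \<open>P 1 = Q 1 = 1\<close> such that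
  \<open>P\<close> is harmonic for the walk killed in the sink and \<open>-Q\<close> solves the equation of the mean
  absorption time. Summing second differences gives \<open>P (x\<^sub>n) = p\<^sub>n\<close> and \<open>Q (x\<^sub>n) = q\<^sub>n\<close>.
  The Wronskian of \<open>P\<close> and \<open>Q\<close> has the increments \<open>2 P\<close> or \<open>3 P\<close>, hence \<open>Q / P\<close> increases
  strictly. If the mean absorption time \<open>E\<close> is finite, then \<open>E = (E 1 + 1) P - Q\<close>, and \<open>E \<ge> 0\<close>
  bounds \<open>Q / P\<close>. Conversely, if \<open>Q / P \<le> c\<close> at the traps, then everywhere by monotonicity, and
  \<open>c P - Q\<close> is a nonnegative solution of the equation of which \<open>E\<close> is the least one.\<close>

section \<open>The two solutions of the recurrence\<close>

definition num_targets :: "nat set \<Rightarrow> nat \<Rightarrow> real" where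
  "num_targets D y = (if y \<in> D then 3 else 2)"

text \<open>The mean-value equation of the kernel, with value 0 at the sink, multiplied by the
  number of targets and solved for the rightmost site.\<close>

fun hom_sol :: "nat set \<Rightarrow> nat \<Rightarrow> real" where
  "hom_sol D 0 = 0"
| "hom_sol D (Suc 0) = 1"
| "hom_sol D (Suc (Suc y)) = num_targets D (Suc y) * hom_sol D (Suc y) - hom_sol D y"

text \<open>Here \<open>-inhom_sol\<close> equals 1 plus its average over the targets. The value 1
  at site 1 is what produces the leading square in \<open>trap_q\<close>.\<close>

fun inhom_sol :: "nat set \<Rightarrow> nat \<Rightarrow> real" where
  "inhom_sol D 0 = 0"
| "inhom_sol D (Suc 0) = 1"
| "inhom_sol D (Suc (Suc y)) =
     num_targets D (Suc y) * (inhom_sol D (Suc y) + 1) - inhom_sol D y"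

text \<open>As \<open>num_targets\<close> is at least 2, the increments never decrease, and the
  first one is 1.\<close>

lemma hom_sol_increasing: "0 \<le> hom_sol D y \<and> hom_sol D y < hom_sol D (Suc y)"
proof (induction y)
  case (Suc y)
  have "2 * hom_sol D (Suc y) \<le> num_targets D (Suc y) * hom_sol D (Suc y)"
    using Suc by (intro mult_right_mono) (auto simp: num_targets_def)
  with Suc show ?case unfolding hom_sol.simps(3) by linarith
qed simp

lemma hom_sol_pos: "y \<ge> 1 \<Longrightarrow> 0 < hom_sol D y"
  using hom_sol_increasing[of D "y - 1"] by simp

text \<open>The product of both solutions at the middle site cancels, so passing to the next
  Wronskian adds the positive term \<open>num_targets * hom_sol\<close> at that site.\<close>

lemma wronskian_pos:
  "0 < inhom_sol D (Suc (Suc y)) * hom_sol D (Suc y) - inhom_sol D (Suc y) * hom_sol D (Suc (Suc y))"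
proof (induction y)
  case 0
  show ?case by (simp add: num_targets_def)
next
  case (Suc y)
  have "0 < num_targets D (Suc (Suc y)) * hom_sol D (Suc (Suc y))"
    using hom_sol_pos[of "Suc (Suc y)" D] by (simp add: num_targets_def del: hom_sol.simps)
  then show ?case
    using Suc unfolding hom_sol.simps(3)[of D "Suc y"] inhom_sol.simps(3)[of D "Suc y"]
    by (simp add: algebra_simps del: hom_sol.simps inhom_sol.simps)
qed

lemma ratio_strict_mono: "strict_mono_on {1..} (\<lambda>y. inhom_sol D y / hom_sol D y)"
proof -
  have step: "inhom_sol D (Suc y) / hom_sol D (Suc y) <
      inhom_sol D (Suc (Suc y)) / hom_sol D (Suc (Suc y))" for y
    using wronskian_pos[of D y] hom_sol_pos[of "Suc y" D] hom_sol_pos[of "Suc (Suc y)" D]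
    by (simp add: divide_simps del: hom_sol.simps inhom_sol.simps)
  \<comment> \<open>The shift by one avoids the vanishing denominator at site 0.\<close>
  have mono: "strict_mono (\<lambda>y. inhom_sol D (Suc y) / hom_sol D (Suc y))"
    using step by (intro strict_mono_Suc_iff[THEN iffD2] allI)
  show ?thesis
  proof (rule strict_mono_onI)
    fix r s :: nat assume "r \<in> {1..}" "s \<in> {1..}" "r < s"
    then show "inhom_sol D r / hom_sol D r < inhom_sol D s / hom_sol D s"
      using strict_monoD[OF mono, of "r - 1" "s - 1"] by simp
  qed
qed

lemma ratio_ge_1:
  assumes "y \<ge> 1"
  shows "1 \<le> inhom_sol D y / hom_sol D y"
  using strict_mono_on_leD[OF ratio_strict_mono[of D], of 1 y] assms by simp

text \<open>Double summation: \<open>real y - real i\<close> is the Green function of the second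
  difference. With \<open>c = 2\<close> the first two terms add up to the square of
  \<open>y\<close>.\<close>

lemma second_difference_solution:
  fixes f h :: "nat \<Rightarrow> real"
  assumes "f 0 = 0" "f 1 = 1" "h 0 = 0"
    and rec: "\<And>y. f (Suc (Suc y)) = 2 * f (Suc y) - f y + c + h (Suc y)"
  shows "f y = real y + c * (real y * (real y - 1) / 2) + (\<Sum>i<y. (real y - real i) * h i)"
proof (induction y rule: induct_nat_012)
  case (ge2 y)
  \<comment> \<open>The weights are affine in \<open>y\<close>, so the old terms have zero second
    difference; among the new ones the terms at \<open>y\<close> cancel and \<open>h (Suc y)\<close>
    remains.\<close>
  have "(\<Sum>i<y. (real (Suc (Suc y)) - real i) * h i) =
      2 * (\<Sum>i<y. (real (Suc y) - real i) * h i) - (\<Sum>i<y. (real y - real i) * h i)"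
    unfolding sum_distrib_left sum_subtractf[symmetric]
    by (intro sum.cong refl) (simp add: algebra_simps)
  then show ?case
    unfolding rec ge2 by (simp add: field_simps)
qed (use assms in auto)

text \<open>By strict monotonicity the traps below \<open>x n\<close> are exactly
  \<open>x 1, ..., x (n - 1)\<close>, without repetition.\<close>

lemma sum_over_range:
  fixes x :: "nat \<Rightarrow> nat" and F g :: "nat \<Rightarrow> real"
  assumes mono: "strict_mono_on {1..} x" and "n \<ge> 1"
  shows "(\<Sum>i<x n. F i * (if i \<in> x ` {1..} then g i else 0)) = (\<Sum>i=1..<n. F (x i) * g (x i))"
proof -
  have less: "x i < x j \<longleftrightarrow> i < j" if "i \<ge> 1" "j \<ge> 1" for i j
    using strict_mono_on_less[OF mono] that by auto
  have "inj_on x {1..<n}"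
    using strict_mono_on_imp_inj_on[OF mono] by (rule inj_on_subset) auto
  then have "(\<Sum>i=1..<n. F (x i) * g (x i)) = (\<Sum>i\<in>x ` {1..<n}. F i * g i)"
    by (simp add: sum.reindex)
  also have "\<dots> = (\<Sum>i<x n. F i * (if i \<in> x ` {1..} then g i else 0))"
    using less \<open>n \<ge> 1\<close> by (intro sum.mono_neutral_cong_left) auto
  finally show ?thesis ..
qed

text \<open>A trap has one target more than the other sites, so it adds the source
  \<open>hom_sol\<close> resp. \<open>inhom_sol + 1\<close> to the second difference, whose constant
  part is 0 resp. 2. Summation gives the recursions of \<open>trap_p\<close> and
  \<open>trap_q\<close>.\<close>

lemma
  fixes x :: "nat \<Rightarrow> nat"
  assumes pos: "0 < x 1" and mono: "strict_mono_on {1..} x" and n: "n \<ge> 1"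
  defines "D \<equiv> x ` {1..}"
  shows trap_p_eq_hom_sol: "trap_p x n = hom_sol D (x n)"
    and trap_q_eq_inhom_sol: "trap_q x n = inhom_sol D (x n)"
proof -
  have 0: "0 \<notin> D"
    using strict_mono_on_leD[OF mono, of 1] pos unfolding D_def by force
  have hom_rec: "hom_sol D (Suc (Suc y)) =
      2 * hom_sol D (Suc y) - hom_sol D y + 0 + (if Suc y \<in> D then hom_sol D (Suc y) else 0)" for y
    by (simp add: num_targets_def)
  have inhom_rec: "inhom_sol D (Suc (Suc y)) =
      2 * inhom_sol D (Suc y) - inhom_sol D y + 2 + (if Suc y \<in> D then inhom_sol D (Suc y) + 1 else 0)" for y
    by (simp add: num_targets_def)
  have hom: "hom_sol D (x n) = real (x n) + (\<Sum>i=1..<n. (real (x n) - real (x i)) * hom_sol D (x i))"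
    if "n \<ge> 1" for n
    unfolding sum_over_range[OF mono that, of "\<lambda>i. real (x n) - real i" "hom_sol D", folded D_def, symmetric]
    by (subst second_difference_solution[where h = "\<lambda>i. if i \<in> D then hom_sol D i else 0", OF _ _ _ hom_rec])
      (use 0 in simp_all)
  have inhom: "inhom_sol D (x n) =
      (real (x n))\<^sup>2 + (\<Sum>i=1..<n. (real (x n) - real (x i)) * (inhom_sol D (x i) + 1))"
    if "n \<ge> 1" for n
    unfolding sum_over_range[OF mono that, of "\<lambda>i. real (x n) - real i" "\<lambda>i. inhom_sol D i + 1", folded D_def, symmetric]
    by (subst second_difference_solution[where h = "\<lambda>i. if i \<in> D then inhom_sol D i + 1 else 0", OF _ _ _ inhom_rec])
      (use 0 in \<open>simp_all add: field_simps power2_eq_square\<close>)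
  show "trap_p x n = hom_sol D (x n)"
    using n
  proof (induction n rule: less_induct)
    case (less n)
    show ?case
      unfolding trap_p.simps[of x n] hom[OF less.prems]
      using less.IH by (intro arg_cong2[where f = "(+)"] sum.cong) auto
  qed
  show "trap_q x n = inhom_sol D (x n)"
    using n
  proof (induction n rule: less_induct)
    case (less n)
    show ?case
      unfolding trap_q.simps[of x n] inhom[OF less.prems]
      using less.IH by (intro arg_cong2[where f = "(+)"] sum.cong) auto
  qed
qed

section \<open>The mean absorption time\<close>

text \<open>Law of the first \<open>n + 1\<close> positions, built from the first step on so that it
  suits first-step analysis.\<close>

primrec path_pmf :: "nat set \<Rightarrow> nat \<Rightarrow> state \<Rightarrow> state list pmf" where
  "path_pmf D 0 a = return_pmf [a]"
| "path_pmf D (Suc n) a = bind_pmf (trapped_kernel D a) (\<lambda>b. map_pmf (Cons a) (path_pmf D n b))"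

lemma length_path_pmf: "xs \<in> set_pmf (path_pmf D n a) \<Longrightarrow> length xs = Suc n"
  by (induction n arbitrary: a xs) auto

lemma pmf_path_pmf:
  assumes "length xs = Suc n"
  shows "ennreal (pmf (path_pmf D n a) xs) =
    (if xs ! 0 = a then \<Prod>i<n. ennreal (pmf (trapped_kernel D (xs ! i)) (xs ! Suc i)) else 0)"
  using assms
proof (induction n arbitrary: a xs)
  case 0
  then obtain z where "xs = [z]" by (auto simp: length_Suc_conv)
  then show ?case by (auto simp: pmf_return)
next
  case (Suc n)
  then obtain z ys where xs: "xs = z # ys" and ys: "length ys = Suc n"
    by (auto simp: length_Suc_conv)
  let ?p = "\<Prod>i<n. ennreal (pmf (trapped_kernel D (ys ! i)) (ys ! Suc i))"
  show ?case
  proof (cases "z = a")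
    case True
    have "ennreal (pmf (path_pmf D (Suc n) a) xs) =
        (\<integral>\<^sup>+b. ennreal (pmf (path_pmf D n b) ys) \<partial>trapped_kernel D a)"
      by (simp add: ennreal_pmf_bind xs True pmf_map_inj')
    \<comment> \<open>By the induction hypothesis only the successor \<open>b = ys ! 0\<close>
      contributes.\<close>
    also have "\<dots> = (\<integral>\<^sup>+b. ?p * indicator {ys ! 0} b \<partial>trapped_kernel D a)"
      by (intro nn_integral_cong) (auto simp: Suc.IH[OF ys])
    also have "\<dots> = ?p * ennreal (pmf (trapped_kernel D a) (ys ! 0))"
      by (simp add: nn_integral_cmult_indicator emeasure_pmf_single)
    finally show ?thesis
      by (simp add: xs True prod.lessThan_Suc_shift mult.commute del: prod.lessThan_Suc)
  next
    case False
    then have "pmf (path_pmf D (Suc n) a) xs = 0"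
      by (auto simp: xs pmf_eq_0_set_pmf)
    with False show ?thesis by (simp add: xs)
  qed
qed

section \<open>Initial segments of paths under the walk law\<close>

lemma space_walk_law: "space (walk_law D a) = UNIV"
  using sets_eq_imp_space_eq[OF sets_walk_law] by (simp add: space_PiM)

lemma measurable_walk_law_map:
  "(\<lambda>\<omega>. map \<omega> is) \<in> measurable (walk_law D a) (count_space UNIV)"
proof (induction "is")
  case (Cons i "is")
  have "(\<lambda>\<omega>. \<omega> i) \<in> measurable (walk_law D a) (count_space UNIV)"
    unfolding measurable_cong_sets[OF sets_walk_law refl]
    by (rule measurable_component_singleton) simp
  moreover have "(\<lambda>\<omega>. s # map \<omega> is) \<in> measurable (walk_law D a) (count_space UNIV)" for s
    using Cons by (rule measurable_compose) simp
  ultimately show ?case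
    using measurable_compose_countable[where f = "\<lambda>s \<omega>. s # map \<omega> is" and g = "\<lambda>\<omega>. \<omega> i"] by simp
qed simp

text \<open>There are countably many lists, so it suffices to compare singletons, whose masses are
  the cylinder probabilities.\<close>

lemma distr_walk_law:
  "distr (walk_law D a) (count_space UNIV) (\<lambda>\<omega>. map \<omega> [0..<Suc n]) = measure_pmf (path_pmf D n a)"
proof (rule measure_eqI_countable[where A = UNIV])
  fix xs :: "state list"
  have "emeasure (distr (walk_law D a) (count_space UNIV) (\<lambda>\<omega>. map \<omega> [0..<Suc n])) {xs} =
      emeasure (walk_law D a) {\<omega>. map \<omega> [0..<Suc n] = xs}"
    using measurable_walk_law_map by (subst emeasure_distr) (auto simp: space_walk_law vimage_def simp del: upt_Suc)
  also have "\<dots> = emeasure (path_pmf D n a) {xs}"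
  proof (cases "length xs = Suc n")
    case True
    then have "{\<omega>. map \<omega> [0..<Suc n] = xs} = {\<omega>. \<forall>i\<le>n. \<omega> i = xs ! i}"
      by (auto simp: list_eq_iff_nth_eq less_Suc_eq_le simp del: upt_Suc)
    then show ?thesis
      by (simp add: walk_law_cylinder emeasure_pmf_single pmf_path_pmf[OF True] del: upt_Suc)
  next
    case False
    then have "xs \<notin> set_pmf (path_pmf D n a)" "{\<omega>. map \<omega> [0..<Suc n] = xs} = {}"
      using length_path_pmf by auto
    then show ?thesis
      by (simp add: emeasure_pmf_single pmf_eq_0_set_pmf del: upt_Suc)
  qed
  finally show "emeasure (distr (walk_law D a) (count_space UNIV) (\<lambda>\<omega>. map \<omega> [0..<Suc n])) {xs} =
      emeasure (path_pmf D n a) {xs}" .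
qed auto

text \<open>The probability of \<open>T > n\<close>, by conditioning on the first step.\<close>

primrec survival :: "nat set \<Rightarrow> nat \<Rightarrow> state \<Rightarrow> ennreal" where
  "survival D 0 a = (if a \<in> {Site 0, Sink} then 0 else 1)"
| "survival D (Suc n) a =
     (if a \<in> {Site 0, Sink} then 0 else \<integral>\<^sup>+b. survival D n b \<partial>trapped_kernel D a)"

lemma emeasure_path_pmf_unabsorbed:
  "emeasure (path_pmf D n a) {xs. set xs \<inter> {Site 0, Sink} = {}} = survival D n a"
proof (induction n arbitrary: a)
  case (Suc n)
  let ?U = "{xs. set xs \<inter> {Site 0, Sink} = {}}"
  have "emeasure (path_pmf D (Suc n) a) ?U = (\<integral>\<^sup>+xs. indicator ?U xs \<partial>path_pmf D (Suc n) a)"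
    by (rule nn_integral_indicator[symmetric]) simp
  also have "\<dots> =
      (\<integral>\<^sup>+b. \<integral>\<^sup>+xs. indicator ?U (a # xs) \<partial>path_pmf D n b \<partial>trapped_kernel D a)"
    unfolding path_pmf.simps nn_integral_bind_pmf nn_integral_map_pmf ..
  also have "\<dots> = (\<integral>\<^sup>+b. (if a \<in> {Site 0, Sink} then 0 else emeasure (path_pmf D n b) ?U) \<partial>trapped_kernel D a)"
    by (intro nn_integral_cong) (auto simp: indicator_def simp flip: nn_integral_indicator)
  finally show ?case
    using Suc by simp
qed (auto simp: indicator_def)

lemma emeasure_unabsorbed:
  "emeasure (walk_law D a) {\<omega>. \<forall>i\<le>n. \<omega> i \<notin> {Site 0, Sink}} = survival D n a"
    and sets_unabsorbed: "{\<omega>. \<forall>i\<le>n. \<omega> i \<notin> {Site 0, Sink}} \<in> sets (walk_law D a)"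
proof -
  let ?U = "{xs. set xs \<inter> {Site 0, Sink} = {}}"
  have eq: "{\<omega>. \<forall>i\<le>n. \<omega> i \<notin> {Site 0, Sink}} = (\<lambda>\<omega>. map \<omega> [0..<Suc n]) -` ?U \<inter> space (walk_law D a)"
    unfolding vimage_def mem_Collect_eq set_map set_upt atLeast0LessThan lessThan_Suc_atMost space_walk_law
    by blast
  show "{\<omega>. \<forall>i\<le>n. \<omega> i \<notin> {Site 0, Sink}} \<in> sets (walk_law D a)"
    unfolding eq using measurable_walk_law_map by (rule measurable_sets) simp
  show "emeasure (walk_law D a) {\<omega>. \<forall>i\<le>n. \<omega> i \<notin> {Site 0, Sink}} = survival D n a"
    unfolding eq emeasure_path_pmf_unabsorbed[symmetric] distr_walk_law[symmetric]
    using measurable_walk_law_map by (subst emeasure_distr) (auto simp del: upt_Suc)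
qed

text \<open>The tail-sum formula: \<open>T\<close> counts the times \<open>n\<close> with
  \<open>T > n\<close>.\<close>

lemma absorption_time_eq_suminf:
  "absorption_time \<omega> = (\<Sum>n. indicator {\<omega>. \<forall>i\<le>n. \<omega> i \<notin> {Site 0, Sink}} \<omega>)"
proof (cases "\<exists>n. \<omega> n \<in> {Site 0, Sink}")
  case True
  define m where "m = (LEAST n. \<omega> n \<in> {Site 0, Sink})"
  have m: "\<omega> m \<in> {Site 0, Sink}"
    unfolding m_def using True by (rule LeastI_ex)
  have least: "m \<le> n" if "\<omega> n \<in> {Site 0, Sink}" for n
    unfolding m_def using that by (rule Least_le)
  have "absorption_time \<omega> = of_nat m"
    unfolding absorption_time_def
    by (intro antisym INF_greatest INF_lower) (use m least in auto)
  moreover have "(\<Sum>n. indicator {\<omega>. \<forall>i\<le>n. \<omega> i \<notin> {Site 0, Sink}} \<omega> :: ennreal) =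
      (\<Sum>n<m. indicator {\<omega>. \<forall>i\<le>n. \<omega> i \<notin> {Site 0, Sink}} \<omega>)"
  proof (rule suminf_finite)
    fix n assume "n \<notin> {..<m}"
    then show "indicator {\<omega>. \<forall>i\<le>n. \<omega> i \<notin> {Site 0, Sink}} \<omega> = (0 :: ennreal)"
      using m by (auto simp: indicator_def not_less)
  qed simp
  moreover have "\<dots> = (\<Sum>n<m. 1)"
  proof (rule sum.cong)
    fix n assume "n \<in> {..<m}"
    then show "indicator {\<omega>. \<forall>i\<le>n. \<omega> i \<notin> {Site 0, Sink}} \<omega> = (1 :: ennreal)"
      using least by (force simp: indicator_def)
  qed simp
  ultimately show ?thesis by simp
next
  case False
  \<comment> \<open>Without absorption the infimum over the empty set is infinite, and so is the
    series of ones.\<close>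
  then have empty: "{n. \<omega> n \<in> {Site 0, Sink}} = {}" by auto
  have "(\<Sum>n. 1 :: ennreal) = \<infinity>"
    by (simp add: suminf_eq_SUP ennreal_SUP_of_nat_eq_top)
  with False show ?thesis unfolding absorption_time_def empty by (simp add: indicator_def)
qed

section \<open>First-step analysis of the mean absorption time\<close>

definition mean_time :: "nat set \<Rightarrow> state \<Rightarrow> ennreal" where
  "mean_time D a = (\<Sum>n. survival D n a)"

lemma expected_absorption_time_eq: "expected_absorption_time D y = mean_time D (Site y)"
proof -
  have "expected_absorption_time D y =
      (\<Sum>n. \<integral>\<^sup>+\<omega>. indicator {\<omega>. \<forall>i\<le>n. \<omega> i \<notin> {Site 0, Sink}} \<omega> \<partial>walk_law D (Site y))"
    unfolding expected_absorption_time_def absorption_time_eq_suminf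
    by (intro nn_integral_suminf borel_measurable_indicator sets_unabsorbed)
  then show ?thesis
    unfolding mean_time_def nn_integral_indicator[OF sets_unabsorbed] emeasure_unabsorbed .
qed

lemma mean_time_step:
  "mean_time D a =
    (if a \<in> {Site 0, Sink} then 0 else 1 + (\<integral>\<^sup>+b. mean_time D b \<partial>trapped_kernel D a))"
proof (cases "a \<in> {Site 0, Sink}")
  case True
  then have "survival D n a = 0" for n by (cases n) auto
  with True show ?thesis by (simp add: mean_time_def)
next
  case False
  have "mean_time D a = (\<Sum>n. survival D (Suc n) a) + survival D 0 a"
    unfolding mean_time_def using suminf_offset[of "\<lambda>n. survival D n a" 1] by simp
  also have "(\<Sum>n. survival D (Suc n) a) = (\<integral>\<^sup>+b. mean_time D b \<partial>trapped_kernel D a)"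
    unfolding mean_time_def using False by (simp add: nn_integral_suminf)
  finally show ?thesis using False by (simp add: add.commute)
qed

text \<open>The partial sums are the means of \<open>T\<close> truncated at \<open>n\<close>. They
  obey the first-step recursion, so induction on \<open>n\<close> keeps them below any
  supersolution.\<close>

lemma mean_time_least:
  assumes super: "\<And>a. a \<notin> {Site 0, Sink} \<Longrightarrow> 1 + (\<integral>\<^sup>+b. f b \<partial>trapped_kernel D a) \<le> f a"
  shows "mean_time D a \<le> f a"
proof -
  have "(\<Sum>i<n. survival D i a) \<le> f a" for n
  proof (induction n arbitrary: a)
    case (Suc n)
    show ?case
    proof (cases "a \<in> {Site 0, Sink}")
      case True
      then have "survival D i a = 0" for i by (cases i) auto
      then show ?thesis by simp
    next
      case False
      have "(\<Sum>i<Suc n. survival D i a) = 1 + (\<integral>\<^sup>+b. (\<Sum>i<n. survival D i b) \<partial>trapped_kernel D a)"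
        using False by (simp add: sum.lessThan_Suc_shift nn_integral_sum del: sum.lessThan_Suc)
      also have "\<dots> \<le> 1 + (\<integral>\<^sup>+b. f b \<partial>trapped_kernel D a)"
        by (intro add_left_mono nn_integral_mono) (rule Suc)
      also have "\<dots> \<le> f a" using False by (rule super)
      finally show ?thesis .
    qed
  qed simp
  then show ?thesis
    unfolding mean_time_def by (intro suminf_le_const) auto
qed

text \<open>A sink of value 0 changes only the divisor, so traps and ordinary sites share one
  formula.\<close>

lemma nn_integral_trapped_kernel:
  assumes "f Sink = 0"
  shows "(\<integral>\<^sup>+b. f b \<partial>trapped_kernel D (Site (Suc y))) =
    (f (Site y) + f (Site (Suc (Suc y)))) / ennreal (num_targets D (Suc y))"
  using assms by (simp add: nn_integral_pmf_of_set num_targets_def)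

section \<open>The criterion\<close>

lemma mean_time_finite_imp_ratio_bounded:
  assumes fin: "mean_time D (Site 1) < \<infinity>" and "y \<ge> 1"
  shows "inhom_sol D y / hom_sol D y \<le> enn2real (mean_time D (Site 1)) + 1"
proof -
  define e where "e y = enn2real (mean_time D (Site y))" for y
  have e0: "mean_time D (Site 0) = 0" and sink: "mean_time D Sink = 0"
    by (simp_all add: mean_time_step)
  have k: "0 < num_targets D y" for y
    by (simp add: num_targets_def)
  have step: "mean_time D (Site (Suc y)) =
      1 + (mean_time D (Site y) + mean_time D (Site (Suc (Suc y)))) / ennreal (num_targets D (Suc y))" for y
    using nn_integral_trapped_kernel[of "mean_time D", OF sink]
    by (subst mean_time_step) simp
  \<comment> \<open>An infinite value at a site would force an infinite value at its left neighbour,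
    so finiteness spreads to the right from sites 0 and 1.\<close>
  have finite: "mean_time D (Site y) < \<infinity>" for y
  proof (induction y rule: induct_nat_012)
    case (ge2 y)
    then show ?case
      using step[of y] k[of "Suc y"]
      by (cases "mean_time D (Site (Suc (Suc y))) = \<top>") (auto simp: ennreal_top_divide less_top)
  qed (use e0 fin in auto)
  have E: "mean_time D (Site y) = ennreal (e y)" and e_nonneg: "0 \<le> e y" for y
    using finite[of y] by (simp_all add: e_def)
  have rec: "e (Suc (Suc y)) = num_targets D (Suc y) * (e (Suc y) - 1) - e y" for y
  proof -
    have "ennreal (e (Suc y)) = ennreal (1 + (e y + e (Suc (Suc y))) / num_targets D (Suc y))"
      using step[of y] k[of "Suc y"] e_nonneg unfolding E
      by (simp add: divide_ennreal add_nonneg_nonneg flip: ennreal_plus ennreal_1)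
    then have "e (Suc y) = 1 + (e y + e (Suc (Suc y))) / num_targets D (Suc y)"
      using k[of "Suc y"] e_nonneg by (subst (asm) ennreal_inj) (auto intro!: add_nonneg_nonneg divide_nonneg_pos)
    then show ?thesis using k[of "Suc y"] by (simp add: field_simps)
  qed
  \<comment> \<open>Both sides satisfy \<open>rec\<close>; the coefficient \<open>e 1 + 1\<close> is
    forced by the value at site 1.\<close>
  have "e y = (e 1 + 1) * hom_sol D y - inhom_sol D y"
  proof (induction y rule: induct_nat_012)
    case 0 show ?case by (simp add: e_def e0)
  next
    case (ge2 y)
    show ?case unfolding rec ge2 by (simp add: algebra_simps)
  qed simp
  with e_nonneg[of y] have "inhom_sol D y \<le> (e 1 + 1) * hom_sol D y" by simp
  then show ?thesis
    using hom_sol_pos[OF \<open>y \<ge> 1\<close>, of D] by (simp add: e_def pos_divide_le_eq)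
qed

lemma ratio_bounded_imp_mean_time_finite:
  assumes bound: "\<And>y. y \<ge> 1 \<Longrightarrow> inhom_sol D y / hom_sol D y \<le> c"
  shows "mean_time D (Site y) < \<infinity>"
proof -
  define g where "g y = c * hom_sol D y - inhom_sol D y" for y
  define f where "f a = (case a of Sink \<Rightarrow> 0 | Site y \<Rightarrow> ennreal (g y))" for a
  \<comment> \<open>Nonnegativity ensures that \<open>ennreal\<close> truncates nothing in
    \<open>f\<close>; site 0, outside the range of \<open>bound\<close>, has
    \<open>g 0 = 0\<close>.\<close>
  have g_nonneg: "0 \<le> g y" for y
    using bound[of y] hom_sol_pos[of y D]
    by (cases "y = 0") (simp_all add: g_def pos_divide_le_eq Suc_le_eq)
  have "mean_time D a \<le> f a" for a
  proof (rule mean_time_least)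
    fix a assume "a \<notin> {Site 0, Sink}"
    then obtain y where a: "a = Site (Suc y)"
      by (cases a) (auto simp: gr0_conv_Suc)
    have k: "0 < num_targets D (Suc y)" by (simp add: num_targets_def)
    have "1 + (\<integral>\<^sup>+b. f b \<partial>trapped_kernel D a) =
        ennreal (1 + (g y + g (Suc (Suc y))) / num_targets D (Suc y))"
      unfolding a using k g_nonneg
      by (subst nn_integral_trapped_kernel)
        (simp_all add: f_def divide_ennreal add_nonneg_nonneg flip: ennreal_plus ennreal_1)
    also have "1 + (g y + g (Suc (Suc y))) / num_targets D (Suc y) = g (Suc y)"
      using k by (simp add: g_def field_simps)
    finally show "1 + (\<integral>\<^sup>+b. f b \<partial>trapped_kernel D a) \<le> f a"
      by (simp add: a f_def)
  qed
  from this[of "Site y"] show ?thesis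
    by (simp add: f_def le_less_trans)
qed

theorem theorem2p6:
  fixes x :: "nat \<Rightarrow> nat"
  assumes "0 < x 1"
    and "strict_mono_on {1..} x"
  shows "(\<forall>n\<ge>1. 0 < trap_q x n / trap_p x n) \<and>
    strict_mono_on {1..} (\<lambda>n. trap_q x n / trap_p x n) \<and>
    (critical (x ` {1..}) \<longleftrightarrow>
      filterlim (\<lambda>n. trap_q x n / trap_p x n) at_top sequentially)"
proof -
  define D where "D = x ` {1..}"
  define r where "r y = inhom_sol D y / hom_sol D y" for y
  have ratio: "trap_q x n / trap_p x n = r (x n)" if "n \<ge> 1" for n
    using trap_p_eq_hom_sol[OF assms that] trap_q_eq_inhom_sol[OF assms that]
    by (simp add: r_def D_def)
  have r_mono: "strict_mono_on {1..} r"
    unfolding r_def by (rule ratio_strict_mono)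
  have x_mono: "x m < x n" if "1 \<le> m" "m < n" for m n
    using strict_mono_onD[OF assms(2), of m n] that by simp
  \<comment> \<open>The traps are cofinal among the sites, so a bound at the traps extends to all
    sites.\<close>
  have x_ge: "n \<le> x n" if "n \<ge> 1" for n
    using that
  proof (induction n rule: dec_induct)
    case base then show ?case using assms(1) by simp
  next
    case (step n)
    then show ?case using x_mono[of n "Suc n"] by simp
  qed
  have pos: "0 < trap_q x n / trap_p x n" if "n \<ge> 1" for n
    using ratio[OF that] ratio_ge_1[of "x n" D] x_ge[OF that] that by (simp add: r_def)
  have mono: "strict_mono_on {1..} (\<lambda>n. trap_q x n / trap_p x n)"
  proof (rule strict_mono_onI)
    fix m n :: nat assume "m \<in> {1..}" "n \<in> {1..}" "m < n"
    then show "trap_q x m / trap_p x m < trap_q x n / trap_p x n"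
      using strict_mono_onD[OF r_mono, of "x m" "x n"] x_ge[of m] x_ge[of n] x_mono[of m n]
      by (simp add: ratio)
  qed
  have crit: "critical D \<longleftrightarrow> mean_time D (Site 1) = \<infinity>"
    unfolding critical_def expected_absorption_time_eq ..
  have "filterlim (\<lambda>n. trap_q x n / trap_p x n) at_top sequentially" if "critical D"
    unfolding filterlim_at_top
  proof
    fix Z :: real
    have "\<exists>n\<ge>1. Z < r (x n)"
    proof (rule ccontr)
      assume *: "\<not> ?thesis"
      \<comment> \<open>The trap \<open>x y\<close> lies at or to the right of \<open>y\<close>, and
        \<open>r\<close> is increasing.\<close>
      have "r y \<le> Z" if "y \<ge> 1" for y
        using strict_mono_on_leD[OF r_mono, of y "x y"] x_ge[OF that] that * by fastforce
      then have "mean_time D (Site 1) < \<infinity>"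
        unfolding r_def by (rule ratio_bounded_imp_mean_time_finite)
      with that crit show False by simp
    qed
    then obtain m where m: "m \<ge> 1" "Z < r (x m)" by blast
    show "\<forall>\<^sub>F n in sequentially. Z \<le> trap_q x n / trap_p x n"
      using eventually_ge_at_top[of m]
    proof eventually_elim
      case (elim n)
      then show ?case
        using strict_mono_on_leD[OF mono, of m n] m ratio[of m] by simp
    qed
  qed
  moreover have "critical D" if lim: "filterlim (\<lambda>n. trap_q x n / trap_p x n) at_top sequentially"
  proof (rule ccontr)
    assume "\<not> critical D"
    then have fin: "mean_time D (Site 1) < \<infinity>"
      by (simp add: crit less_top)
    let ?c = "enn2real (mean_time D (Site 1)) + 1"
    \<comment> \<open>The conjunct \<open>n \<ge> 1\<close> is kept because \<open>ratio\<close>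
      identifies the quotient only there.\<close>
    have "\<forall>\<^sub>F n in sequentially. ?c < trap_q x n / trap_p x n \<and> n \<ge> 1"
      using lim eventually_ge_at_top[of 1] unfolding filterlim_at_top_dense
      by (auto intro: eventually_conj)
    then obtain n where n: "n \<ge> 1" "?c < r (x n)"
      using eventually_happens'[OF sequentially_bot] ratio by fastforce
    then show False
      using mean_time_finite_imp_ratio_bounded[OF fin, of "x n"] x_ge[of n] by (simp add: r_def)
  qed
  ultimately show ?thesis
    using pos mono unfolding D_def by blast
qed

end
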